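(* Let $(G_m)_{m\in\mathbb{Z}}$ be a generalized Fibonacci sequence, let $a,b$ be integers, let $n\ge 0$ be an integer, and let $x$ be a complex number such that $\Delta := 1-L_b x+(-1)^b x^2\neq 0$. Then $$\sum_{k=0}^n x^k k\, G_{a+bk} = -\frac{1}{\Delta}(n+1)x^{n+1} P(1,n+1) - \frac{1}{\Delta^2} \left[ x^{n+2} P(2,n+2) - x P(2,1) \right].$$
   Context: A generalized Fibonacci sequence is a sequence $(G_m)_{m\in\mathbb{Z}}$ of complex numbers with $G_{m+2}=G_{m+1}+G_m$ for all integers $m$ (with arbitrary seed $G_0,G_1$). $L_m$ is the Lucas number: $L_0=2$, $L_1=1$, $L_{m+2}=L_{m+1}+L_m$ for all integers $m$ (including negative indices). For given $a,b,x$ and $G$, and for integers $v,w\ge 0$, $P(v,w) = \sum_{k=0}^v \binom{v}{k} (-1)^{(b+1)k} x^k G_{a+bw-bk}$. Convention: $x^0=1$, also for $x=0$. *)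

theory Defs
  imports Complex_Main
begin

definition gen_fibonacci :: "(int \<Rightarrow> complex) \<Rightarrow> bool" where
  "gen_fibonacci G \<longleftrightarrow> (\<forall>m. G (m + 2) = G (m + 1) + G m)"

(* For negative indices the recurrence is solved for its lowest term. *)
function lucas :: "int \<Rightarrow> int" where
  "lucas m =
    (if m = 0 then 2
     else if m = 1 then 1
     else if m > 1 then lucas (m - 1) + lucas (m - 2)
     else lucas (m + 2) - lucas (m + 1))"
  by pat_completeness auto
termination
  by (relation "measure (\<lambda>m. nat \<bar>2 * m - 1\<bar>)") auto

declare lucas.simps [simp del]

lemma lucas_0: "lucas 0 = 2"
  by (simp add: lucas.simps)

lemma lucas_1: "lucas 1 = 1"
  by (simp add: lucas.simps)

lemma lucas_rec: "lucas (m + 2) = lucas (m + 1) + lucas m"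
proof (cases "m \<ge> 0")
  case True
  then show ?thesis
    by (subst lucas.simps) (simp add: add.commute)
next
  case False
  then show ?thesis
    by (subst (3) lucas.simps) simp
qed

definition fib_P ::
  "(int \<Rightarrow> complex) \<Rightarrow> int \<Rightarrow> int \<Rightarrow> complex \<Rightarrow> nat \<Rightarrow> nat \<Rightarrow> complex" where
  "fib_P G a b x v w =
    (\<Sum>k=0..v. of_nat (v choose k) * (-1) powi ((b + 1) * int k) * x ^ k
      * G (a + b * int w - b * int k))"

end

theory Submission
  imports Defs
begin

text \<open>
  Write \<open>g k\<close> for \<open>G (a + b k)\<close>. The Lucas numbers give
  \<open>g (k + 1) = L g k - (-1)^b g (k - 1)\<close>, with \<open>L\<close> the \<open>b\<close>-th one, and hence
  \<open>\<Delta> P(v, w) = P(v + 1, w) - x P(v + 1, w + 1)\<close>. The cases \<open>v = 0\<close> and \<open>v = 1\<close> make the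
  right-hand side of the theorem telescope in \<open>n\<close>.
\<close>

lemma gen_fibonacci_unique:
  assumes F: "gen_fibonacci F" and G: "gen_fibonacci G"
    and "F 0 = G 0" "F 1 = G 1"
  shows "F m = G m"
proof -
  \<comment> \<open>Agreement on two consecutive indices is what the recurrence carries upward and,
    solved for its lowest term, downward.\<close>
  have "F m = G m \<and> F (m + 1) = G (m + 1)"
  proof (induction m rule: int_induct[where k = 0])
    case base
    then show ?case using assms by simp
  next
    case (step1 i)
    then show ?case
      using F G by (simp add: gen_fibonacci_def add.assoc)
  next
    case (step2 i)
    have "F (i + 1) = F i + F (i - 1)" "G (i + 1) = G i + G (i - 1)"
      using F[unfolded gen_fibonacci_def, rule_format, of "i - 1"]
        G[unfolded gen_fibonacci_def, rule_format, of "i - 1"] by (simp_all add: algebra_simps)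
    then show ?case using step2 by simp
  qed
  then show ?thesis by simp
qed

text \<open>For fixed \<open>m\<close>, both sides are generalized Fibonacci sequences in
  \<open>b\<close> that agree at \<open>b = 0\<close> and \<open>b = 1\<close>.\<close>

lemma gen_fibonacci_add_lucas:
  assumes G: "gen_fibonacci G"
  shows "G (m + b) + (-1) powi b * G (m - b) = of_int (lucas b) * G m"
proof (rule gen_fibonacci_unique
    [of "\<lambda>b. G (m + b) + (-1) powi b * G (m - b)" "\<lambda>b. of_int (lucas b) * G m"])
  have rec: "G (j + 2) = G (j + 1) + G j" for j
    using G by (simp add: gen_fibonacci_def)
  show "gen_fibonacci (\<lambda>b. G (m + b) + (-1) powi b * G (m - b))"
    unfolding gen_fibonacci_def
  proof
    fix j
    have "G (m + (j + 2)) = G (m + (j + 1)) + G (m + j)"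
      using rec[of "m + j"] by (simp add: algebra_simps)
    \<comment> \<open>Read backwards, the recurrence acquires a minus sign, which the alternating
      factor \<open>(-1) powi j\<close> absorbs.\<close>
    moreover have "G (m - j) = G (m - (j + 1)) + G (m - (j + 2))"
      using rec[of "m - j - 2"] by (simp add: algebra_simps)
    ultimately show "G (m + (j + 2)) + (-1) powi (j + 2) * G (m - (j + 2))
        = G (m + (j + 1)) + (-1) powi (j + 1) * G (m - (j + 1)) + (G (m + j) + (-1) powi j * G (m - j))"
      by (simp add: power_int_add algebra_simps)
  qed
  show "gen_fibonacci (\<lambda>b. of_int (lucas b) * G m)"
    by (simp add: gen_fibonacci_def lucas_rec algebra_simps)
  show "G (m + 0) + (-1) powi 0 * G (m - 0) = of_int (lucas 0) * G m"
    by (simp add: lucas_0)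
  show "G (m + 1) + (-1) powi 1 * G (m - 1) = of_int (lucas 1) * G m"
    using rec[of "m - 1"] by (simp add: lucas_1 add.commute)
qed

lemma fib_P_1: "fib_P G a b x 1 w
    = G (a + b * int w) - (-1) powi b * x * G (a + b * int w - b)"
  by (simp add: fib_P_def power_int_add)

lemma fib_P_2: "fib_P G a b x 2 w
    = G (a + b * int w) - 2 * (-1) powi b * x * G (a + b * int w - b)
      + x ^ 2 * G (a + b * int w - 2 * b)"
proof -
  have "{0..2::nat} = {0, 1, 2}" by auto
  moreover have "(-1::complex) powi ((b + 1) * 2) = 1"
    by (simp add: power_int_minus_left)
  ultimately show ?thesis
    by (simp add: fib_P_def power_int_add algebra_simps)
qed

text \<open>The case \<open>v = 0\<close>, since \<open>P(0, w)\<close> is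
  \<open>G (a + b * int w)\<close>; the Lucas identity replaces the middle term of
  \<open>\<Delta>\<close>.\<close>

lemma fib_P_1_step:
  assumes "gen_fibonacci G"
    and \<Delta>: "\<Delta> = 1 - of_int (lucas b) * x + (-1) powi b * x ^ 2"
  shows "\<Delta> * G (a + b * int w) = fib_P G a b x 1 w - x * fib_P G a b x 1 (Suc w)"
  using gen_fibonacci_add_lucas[OF assms(1), of "a + b * int w" b, symmetric]
  unfolding \<Delta> fib_P_1 by (simp add: algebra_simps power2_eq_square)

text \<open>\<open>P(1, w)\<close> combines two terms of \<open>G\<close> at distance
  \<open>b\<close>, so the Lucas identity is applied at both of them.\<close>

lemma fib_P_2_step:
  assumes "gen_fibonacci G"
    and \<Delta>: "\<Delta> = 1 - of_int (lucas b) * x + (-1) powi b * x ^ 2"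
  shows "\<Delta> * fib_P G a b x 1 w = fib_P G a b x 2 w - x * fib_P G a b x 2 (Suc w)"
proof -
  define m where "m = a + b * int w"
  define e where "e = (-1::complex) powi b"
  define l where "l = (of_int (lucas b) :: complex)"
  \<comment> \<open>Needed for the coefficients of \<open>x ^ 2 * G (m - 2 * b)\<close> and
    \<open>x ^ 3 * G (m - b)\<close>, where the sign occurs squared.\<close>
  have e: "e * e = 1"
    by (simp add: e_def power_int_minus_left)
  have r0: "l * G m = G (m + b) + e * G (m - b)"
    using gen_fibonacci_add_lucas[OF assms(1), of m b] by (simp add: e_def l_def)
  have r1: "l * G (m - b) = G m + e * G (m - 2 * b)"
    using gen_fibonacci_add_lucas[OF assms(1), of "m - b" b] by (simp add: e_def l_def)
  have "(1 - l * x + e * x ^ 2) * (G m - e * x * G (m - b))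
      = G m - 2 * e * x * G (m - b) + x ^ 2 * G (m - 2 * b)
        - x * (G (m + b) - 2 * e * x * G m + x ^ 2 * G (m - b))"
    using e r0 r1 by algebra
  moreover have "a + b * int (Suc w) = m + b"
    by (simp add: m_def algebra_simps)
  ultimately show ?thesis
    unfolding \<Delta> fib_P_1 fib_P_2 by (simp add: m_def e_def l_def algebra_simps)
qed

theorem mainTheorem2:
  fixes G :: "int \<Rightarrow> complex" and a b :: int and n :: nat and x \<Delta> :: complex
  assumes "gen_fibonacci G"
    and "\<Delta> = 1 - of_int (lucas b) * x + (-1) powi b * x ^ 2"
    and "\<Delta> \<noteq> 0"
  shows "(\<Sum>k=0..n. x ^ k * of_nat k * G (a + b * int k)) =
    - (1 / \<Delta>) * of_nat (n + 1) * x ^ (n + 1) * fib_P G a b x 1 (n + 1)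
    - (1 / \<Delta> ^ 2) * (x ^ (n + 2) * fib_P G a b x 2 (n + 2) - x * fib_P G a b x 2 1)"
proof -
  define p where "p w = fib_P G a b x 1 w" for w
  define q where "q w = fib_P G a b x 2 w" for w
  have p: "\<Delta> * G (a + b * int w) = p w - x * p (Suc w)" for w
    unfolding p_def by (rule fib_P_1_step[OF assms(1,2)])
  have q: "\<Delta> * p w = q w - x * q (Suc w)" for w
    unfolding p_def q_def by (rule fib_P_2_step[OF assms(1,2)])
  \<comment> \<open>Multiplying by \<open>\<Delta> ^ 2\<close> keeps the induction free of
    division.\<close>
  have "\<Delta> ^ 2 * (\<Sum>k=0..n. x ^ k * of_nat k * G (a + b * int k)) =
      - \<Delta> * of_nat (n + 1) * x ^ (n + 1) * p (n + 1) - (x ^ (n + 2) * q (n + 2) - x * q 1)"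
  proof (induction n)
    case 0
    show ?case
      \<comment> \<open>The sum is 0, and the right-hand side is
        \<open>- x * (\<Delta> * p 1 - q 1 + x * q 2)\<close>, which vanishes as well.\<close>
      using arg_cong[OF q[of 1], of "(*) x"] by (simp add: numeral_2_eq_2 algebra_simps)
  next
    case (Suc n)
    define c where "c = (of_nat n :: complex)"
    define y where "y = x ^ n"
    have "\<Delta> ^ 2 * (x ^ Suc n * of_nat (Suc n) * G (a + b * int (Suc n)))
        = \<Delta> * (c + 1) * x * y * (\<Delta> * G (a + b * int (Suc n)))"
      by (simp add: c_def y_def power2_eq_square algebra_simps)
    also have "\<dots> = \<Delta> * (c + 1) * x * y * (p (n + 1) - x * p (n + 2))"
      using p[of "Suc n"] by simp
    \<comment> \<open>The weight of \<open>p (n + 2)\<close> is raised from \<open>c + 1\<close> to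
      \<open>c + 2\<close>, so that the \<open>p\<close> terms telescope; the surplus becomes the
      telescoping difference of \<open>q\<close> terms.\<close>
    also have "\<dots> = \<Delta> * (c + 1) * x * y * p (n + 1) - \<Delta> * (c + 2) * x ^ 2 * y * p (n + 2)
        + x ^ 2 * y * (\<Delta> * p (n + 2))"
      by (simp add: power2_eq_square algebra_simps)
    also have "\<Delta> * p (n + 2) = q (n + 2) - x * q (n + 3)"
      using q[of "n + 2"] by (simp add: numeral_3_eq_3)
    finally have new: "\<Delta> ^ 2 * (x ^ Suc n * of_nat (Suc n) * G (a + b * int (Suc n)))
        = \<Delta> * (c + 1) * x * y * p (n + 1) - \<Delta> * (c + 2) * x ^ 2 * y * p (n + 2)
          + x ^ 2 * y * (q (n + 2) - x * q (n + 3))" .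
    show ?case
      unfolding sum.atLeast0_atMost_Suc distrib_left Suc.IH new
      by (simp add: c_def y_def power2_eq_square numeral_3_eq_3 algebra_simps)
  qed
  \<comment> \<open>The division by \<open>\<Delta> ^ 2\<close> is done for arbitrary
    \<open>s\<close>, \<open>c\<close>, \<open>y\<close>, \<open>u\<close>, \<open>v\<close>, so the
    sum and the powers stay intact.\<close>
  moreover have "s = - (1 / \<Delta>) * c * y * u - (1 / \<Delta> ^ 2) * v"
    if "\<Delta> ^ 2 * s = - \<Delta> * c * y * u - v" for s c y u v
  proof -
    have "s = (- \<Delta> * c * y * u - v) / \<Delta> ^ 2"
      using assms(3) that by (simp add: eq_divide_eq mult.commute)
    also have "\<dots> = - (1 / \<Delta>) * c * y * u - (1 / \<Delta> ^ 2) * v"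
      using assms(3) by (simp add: diff_divide_distrib power2_eq_square)
    finally show ?thesis .
  qed
  ultimately show ?thesis
    unfolding p_def q_def by blast
qed

end
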